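(* Let $(X,\eta)$ be a semi-normed space and let $u\in X$. Suppose that $\Lambda\subset B_{X^*}\cap N_\eta^\perp$ is one-norming for $X$. Then, for every $z\in X$, $$V_\eta(X,u,z)=\operatorname{conv}\Big\{\lim \overline{\phi_n(u)}\,\phi_n(z)\ :\ \phi_n\in\Lambda\ \text{for all } n,\ \lim|\phi_n(u)|=\eta(u)\Big\}.$$
   Context: $(X,\eta)$ is a semi-normed space over the scalar field $\mathbb K$ ($\mathbb R$ or $\mathbb C$), and $N_\eta=\ker\eta$. $X^*$ is the dual of $X$, $B_{X^*}$ its closed unit ball, and $N_\eta^\perp$ is the set of functionals in $X^*$ vanishing on $N_\eta$. $X_\eta^*$ denotes the dual of $(X,\eta)$, identified with the dual of the normed quotient $X/N_\eta$ (with norm $\|x+N_\eta\|=\eta(x)$) and with the subspace $\{\phi\in X^*:\phi|_{N_\eta}=0\}$ of $X^*$; its norm is $\|\phi\|_\eta=\sup\{|\phi(x)|:\eta(x)\le 1\}$, and $B_{X_\eta^*}$, $S_{X_\eta^*}$ are its closed unit ball and unit sphere. A subset $\Lambda$ of $B_{X_\eta^*}$ is called one-norming for $(X,\eta)$ if $\eta(x)=\sup_{\phi\in\Lambda}|\phi(x)|$ for all $x\in X$. For $u\in X$, $J_\eta(u)=\{\phi\in S_{X_\eta^*}:\phi(u)=\eta(u)\}$ is the set of support functionals at $u$, and the abstract numerical range of $z\in X$ with respect to $u$ is $V_\eta(X,u,z)=\operatorname{conv}\{\phi(z):\phi\in J_\eta(u)\}$. Here $\operatorname{conv}$ denotes the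 convex hull, and the limits are taken along sequences $(\phi_n)$ in $\Lambda$.
   Formalization: The formal theorem assumes η(u)=1; for arbitrary u the stated equality fails, e.g. X=ℝ, η=|·|, u=2, z=1, Λ={id} gives {1} on the left and {2} on the right. *)

theory Defs
  imports "HOL-Analysis.Analysis"
begin

text \<open>
  The scalar field is kept as a type variable \<open>'k\<close> of class real_normed_field and is
  instantiated to real and to complex. Complex vector spaces have no type class in the
  distribution, so the scalar multiplication \<open>smul\<close> is explicit for both fields.
\<close>

locale seminormed_space = vector_space smul
  for smul :: "'k::real_normed_field \<Rightarrow> 'a::ab_group_add \<Rightarrow> 'a" +
  fixes eta :: "'a \<Rightarrow> real"
  assumes eta_nonneg: "0 \<le> eta x"
    and eta_smul: "eta (smul c x) = norm c * eta x"
    and eta_triangle: "eta (x + y) \<le> eta x + eta y"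

definition seminorm_kernel :: "('a \<Rightarrow> real) \<Rightarrow> 'a set" where
  "seminorm_kernel eta = {x. eta x = 0}"

text \<open>
  The topology of the space is the one given by \<open>eta\<close>. Continuity of a linear functional
  is stated as boundedness; such functionals vanish on the kernel, so this is the dual of
  the space and also the dual of its normed quotient.
\<close>

definition dual ::
  "('k::real_normed_field \<Rightarrow> 'a::ab_group_add \<Rightarrow> 'a) \<Rightarrow> ('a \<Rightarrow> real) \<Rightarrow> ('a \<Rightarrow> 'k) set" where
  "dual smul eta =
    {\<phi>. Vector_Spaces.linear smul (*) \<phi> \<and> (\<exists>C. \<forall>x. norm (\<phi> x) \<le> C * eta x)}"

definition dual_norm :: "('a \<Rightarrow> real) \<Rightarrow> ('a \<Rightarrow> 'k::real_normed_field) \<Rightarrow> real" where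
  "dual_norm eta \<phi> = (SUP x\<in>{x. eta x \<le> 1}. norm (\<phi> x))"

definition dual_ball ::
  "('k::real_normed_field \<Rightarrow> 'a::ab_group_add \<Rightarrow> 'a) \<Rightarrow> ('a \<Rightarrow> real) \<Rightarrow> ('a \<Rightarrow> 'k) set" where
  "dual_ball smul eta = {\<phi> \<in> dual smul eta. dual_norm eta \<phi> \<le> 1}"

definition dual_sphere ::
  "('k::real_normed_field \<Rightarrow> 'a::ab_group_add \<Rightarrow> 'a) \<Rightarrow> ('a \<Rightarrow> real) \<Rightarrow> ('a \<Rightarrow> 'k) set" where
  "dual_sphere smul eta = {\<phi> \<in> dual smul eta. dual_norm eta \<phi> = 1}"

definition kernel_annihilator ::
  "('k::real_normed_field \<Rightarrow> 'a::ab_group_add \<Rightarrow> 'a) \<Rightarrow> ('a \<Rightarrow> real) \<Rightarrow> ('a \<Rightarrow> 'k) set" where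
  "kernel_annihilator smul eta =
    {\<phi> \<in> dual smul eta. \<forall>x\<in>seminorm_kernel eta. \<phi> x = 0}"

definition one_norming ::
  "('k::real_normed_field \<Rightarrow> 'a::ab_group_add \<Rightarrow> 'a) \<Rightarrow> ('a \<Rightarrow> real) \<Rightarrow> ('a \<Rightarrow> 'k) set \<Rightarrow> bool" where
  "one_norming smul eta \<Lambda> \<longleftrightarrow>
    \<Lambda> \<subseteq> dual_ball smul eta \<and> (\<forall>x. eta x = (SUP \<phi>\<in>\<Lambda>. norm (\<phi> x)))"

definition support_functionals ::
  "('k::real_normed_field \<Rightarrow> 'a::ab_group_add \<Rightarrow> 'a) \<Rightarrow> ('a \<Rightarrow> real) \<Rightarrow> 'a \<Rightarrow> ('a \<Rightarrow> 'k) set" where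
  "support_functionals smul eta u = {\<phi> \<in> dual_sphere smul eta. \<phi> u = of_real (eta u)}"

definition numerical_range ::
  "('k::real_normed_field \<Rightarrow> 'a::ab_group_add \<Rightarrow> 'a) \<Rightarrow> ('a \<Rightarrow> real) \<Rightarrow> 'a \<Rightarrow> 'a \<Rightarrow> 'k set" where
  "numerical_range smul eta u z =
    convex hull {\<phi> z |\<phi>. \<phi> \<in> support_functionals smul eta u}"

end

theory Submission
  imports Defs
begin

text \<open>
  The two inclusions are proved by one argument for both scalar fields, and neither of them
  uses an extension theorem for functionals.

  The limits on the right-hand side are support functionals evaluated at \<open>z\<close>: if
  \<open>\<phi>\<^sub>n \<in> \<Lambda>\<close> and \<open>\<bar>\<phi>\<^sub>n u\<bar> \<rightarrow> 1\<close>, then the functionals \<open>x \<mapsto> \<phi>\<^sub>n(u)\<^sup>* \<phi>\<^sub>n(x)\<close> (with \<open>c\<^sup>*\<close> the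
  conjugate of \<open>c\<close>) are dominated by \<open>eta\<close>, so by Tychonoff's theorem they have a pointwise
  cluster point. It is linear, dominated by \<open>eta\<close>, takes the value \<open>1\<close> at \<open>u\<close> and the limit
  value at \<open>z\<close> (lemma \<open>limit_value_is_support_value\<close>).

  For the other inclusion, let \<open>g\<close> be a support functional at \<open>u\<close> and let \<open>d\<close> be a
  scalar, read as a direction in the scalar field with its Euclidean inner product. Almost norming the perturbed vectors \<open>u + t d\<^sup>* z\<close> by elements
  \<open>\<phi>\<close> of \<open>\<Lambda>\<close> and comparing the terms of first order in \<open>t\<close> of
  \<open>\<bar>\<phi>(u + t d\<^sup>* z)\<bar>\<^sup>2 \<ge> \<bar>g(u + t d\<^sup>* z)\<bar>\<^sup>2 - O(t\<^sup>2)\<close> gives, as \<open>t \<rightarrow> 0\<close>, a limit value that is at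
  least as far in direction \<open>d\<close> as \<open>g z\<close> (lemma \<open>limit_value_in_direction\<close>). Since the set
  of limit values is compact, so is its convex hull, and \<open>g z\<close> cannot be separated from it.
\<close>

section \<open>Conjugation in a real normed field\<close>

text \<open>
  This formula is the identity on the reals and complex conjugation on the complex
  numbers, which allows both scalar fields to be treated at once. At \<open>0\<close> it gives \<open>0\<close>.
\<close>

definition conjugate :: "'k::real_normed_field \<Rightarrow> 'k" where
  "conjugate a = of_real ((norm a)\<^sup>2) / a"

lemma conjugate_real [simp]: "conjugate (x::real) = x"
  by (simp add: conjugate_def power2_eq_square)

lemma conjugate_complex [simp]: "conjugate (x::complex) = cnj x"
proof -
  have "of_real ((norm x)\<^sup>2) = cnj x * x"
    by (simp only: complex_norm_square mult.commute)
  then show ?thesis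
    by (cases "x = 0") (simp_all add: conjugate_def del: of_real_power)
qed

lemma norm_conjugate [simp]: "norm (conjugate a) = norm a"
  by (cases "a = 0") (simp_all add: conjugate_def norm_divide norm_power power2_eq_square norm_mult)

lemma conjugate_mult_self: "conjugate a * a = of_real ((norm a)\<^sup>2)"
  by (cases "a = 0") (simp_all add: conjugate_def)

lemma inner_mult_mult:
  fixes a :: "'k::{real_normed_field,real_inner}"
  shows "inner (a * x) (a * y) = (norm a)\<^sup>2 * inner x y"
proof -
  have "inner (a * x) (a * y)
      = ((norm (a * (x + y)))\<^sup>2 - (norm (a * x))\<^sup>2 - (norm (a * y))\<^sup>2) / 2"
    by (simp add: dot_norm distrib_left)
  also have "\<dots> = (norm a)\<^sup>2 * (((norm (x + y))\<^sup>2 - (norm x)\<^sup>2 - (norm y)\<^sup>2) / 2)"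
    by (simp add: norm_mult power_mult_distrib right_diff_distrib)
  finally show ?thesis
    by (simp add: dot_norm)
qed

text \<open>
  Multiplication by \<open>a\<close> is \<open>norm a\<close> times an isometry, so its adjoint is
  \<open>(norm a)\<^sup>2\<close> times its inverse.
\<close>

lemma inner_mult_left_conjugate:
  fixes a :: "'k::{real_normed_field,real_inner}"
  shows "inner (a * x) y = inner x (conjugate a * y)"
proof (cases "a = 0")
  case True
  then show ?thesis by (simp add: conjugate_def)
next
  case False
  have "conjugate a * y = (norm a)\<^sup>2 *\<^sub>R (y / a)"
    by (simp add: conjugate_def scaleR_conv_of_real)
  then have "inner x (conjugate a * y) = inner (a * x) (a * (y / a))"
    by (simp only: inner_mult_mult inner_scaleR_right)
  then show ?thesis
    using False by simp
qed

section \<open>Functionals dominated by the seminorm\<close>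

locale euclidean_seminormed_space = seminormed_space smul eta
  for smul :: "'k::{real_normed_field,euclidean_space} \<Rightarrow> 'a::ab_group_add \<Rightarrow> 'a"
    and eta :: "'a \<Rightarrow> real"
begin

lemma eta_zero: "eta 0 = 0"
  using eta_smul[of 0 0] by simp

lemma dual_linear_iff:
  "Vector_Spaces.linear smul (*) \<phi> \<longleftrightarrow>
    (\<forall>x y. \<phi> (x + y) = \<phi> x + \<phi> y) \<and> (\<forall>c x. \<phi> (smul c x) = c * \<phi> x)"
proof -
  have "vector_space ((*) :: 'k \<Rightarrow> 'k \<Rightarrow> 'k)"
    by unfold_locales (simp_all add: algebra_simps)
  then show ?thesis
    using vector_space_axioms by (simp add: Vector_Spaces.linear_iff)
qed

lemma dual_ball_norm_le:
  assumes "\<phi> \<in> dual_ball smul eta"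
  shows "norm (\<phi> x) \<le> eta x"
proof -
  obtain C where C: "\<And>x. norm (\<phi> x) \<le> C * eta x"
    using assms by (auto simp: dual_ball_def dual_def)
  have scale: "\<phi> (smul c x) = c * \<phi> x" for c x
    using assms by (auto simp: dual_ball_def dual_def dual_linear_iff)
  show ?thesis
  proof (cases "eta x = 0")
    case True
    then show ?thesis using C[of x] by simp
  next
    case False
    then have pos: "eta x > 0"
      using eta_nonneg[of x] by simp
    have "norm (\<phi> y) \<le> \<bar>C\<bar>" if "eta y \<le> 1" for y
    proof -
      have "C * eta y \<le> \<bar>C\<bar> * 1"
        using that eta_nonneg by (intro mult_mono) auto
      then show ?thesis using C[of y] by simp
    qed
    then have bdd: "bdd_above ((\<lambda>y. norm (\<phi> y)) ` {y. eta y \<le> 1})"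
      by (intro bdd_aboveI2[where M = "\<bar>C\<bar>"]) auto
    define y where "y = smul (of_real (inverse (eta x))) x"
    have "eta y \<le> 1"
      using pos by (simp add: y_def eta_smul norm_inverse)
    then have "norm (\<phi> y) \<le> dual_norm eta \<phi>"
      unfolding dual_norm_def by (intro cSUP_upper bdd) auto
    also have "\<dots> \<le> 1"
      using assms by (simp add: dual_ball_def)
    finally show ?thesis
      using pos by (simp add: y_def scale norm_mult norm_inverse norm_divide divide_simps)
  qed
qed

lemma support_functionalsI:
  assumes "eta u = 1" and "Vector_Spaces.linear smul (*) \<phi>"
    and le: "\<And>x. norm (\<phi> x) \<le> eta x" and u: "\<phi> u = 1"
  shows "\<phi> \<in> support_functionals smul eta u"
proof -
  have "dual_norm eta \<phi> = 1"
    unfolding dual_norm_def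
  proof (rule cSup_eq_maximum)
    show "1 \<in> (\<lambda>x. norm (\<phi> x)) ` {x. eta x \<le> 1}"
      by (rule image_eqI[where x = u]) (simp_all add: assms)
    show "y \<le> 1" if "y \<in> (\<lambda>x. norm (\<phi> x)) ` {x. eta x \<le> 1}" for y
      using that le order_trans by blast
  qed
  moreover have "\<exists>C. \<forall>x. norm (\<phi> x) \<le> C * eta x"
    using le by (intro exI[where x = 1]) simp
  ultimately show ?thesis
    using assms by (simp add: support_functionals_def dual_sphere_def dual_def)
qed

lemma support_functionals_subset_dual_ball:
  "support_functionals smul eta u \<subseteq> dual_ball smul eta"
  by (auto simp: support_functionals_def dual_sphere_def dual_ball_def)

end

section \<open>Limit values are values of support functionals\<close>

text \<open>
  The cluster point is described by a filter on the function space, finer than the tail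
  filter of the sequence, because a sequence in a product of uncountably many
  compact spaces need not have a convergent subsequence.
\<close>

lemma pointwise_cluster_filter:
  fixes f :: "nat \<Rightarrow> 'a \<Rightarrow> 'k::euclidean_space"
  assumes "\<And>n x. norm (f n x) \<le> K x"
  obtains g G where "G \<noteq> bot" "G \<le> filtermap f sequentially"
    "\<And>x. ((\<lambda>h. h x) \<longlongrightarrow> g x) G"
proof -
  have "compactin (product_topology (\<lambda>_. euclidean) UNIV) (PiE UNIV (\<lambda>x. cball (0::'k) (K x)))"
    by (simp add: compactin_PiE)
  then have compact: "compact (PiE UNIV (\<lambda>x. cball (0::'k) (K x)))"
    by (simp add: euclidean_product_topology)
  have "eventually (\<lambda>h. h \<in> PiE UNIV (\<lambda>x. cball 0 (K x))) (filtermap f sequentially)"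
    using assms by (simp add: eventually_filtermap PiE_iff)
  then obtain g where g: "inf (nhds g) (filtermap f sequentially) \<noteq> bot"
    using compact[unfolded compact_filter] by (metis filtermap_bot_iff sequentially_bot)
  show thesis
  proof
    show "inf (nhds g) (filtermap f sequentially) \<noteq> bot" by (fact g)
    show "inf (nhds g) (filtermap f sequentially) \<le> filtermap f sequentially" by simp
    show "((\<lambda>h. h x) \<longlongrightarrow> g x) (inf (nhds g) (filtermap f sequentially))" for x
    proof (rule filterlim_mono[OF _ order_refl inf_le1])
      show "((\<lambda>h. h x) \<longlongrightarrow> g x) (nhds g)"
      proof (rule topological_tendstoI)
        fix S :: "'k set" assume "open S" "g x \<in> S"
        moreover from \<open>open S\<close> have "open ((\<lambda>h::'a \<Rightarrow> 'k. h x) -` S)"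
          by (rule open_vimage) (rule continuous_on_product_coordinates)
        ultimately show "eventually (\<lambda>h. h x \<in> S) (nhds g)"
          unfolding eventually_nhds by fastforce
      qed
    qed
  qed
qed

definition limit_values ::
  "('a \<Rightarrow> 'k::real_normed_field) set \<Rightarrow> ('a \<Rightarrow> real) \<Rightarrow> 'a \<Rightarrow> 'a \<Rightarrow> 'k set" where
  "limit_values \<Lambda> eta u z = {l. \<exists>\<phi>. (\<forall>n::nat. \<phi> n \<in> \<Lambda>) \<and>
    (\<lambda>n. norm (\<phi> n u)) \<longlonglongrightarrow> eta u \<and> (\<lambda>n. conjugate (\<phi> n u) * \<phi> n z) \<longlonglongrightarrow> l}"

context euclidean_seminormed_space
begin

lemma limit_value_is_support_value:
  assumes u: "eta u = 1" and ball: "\<Lambda> \<subseteq> dual_ball smul eta"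
    and l: "l \<in> limit_values \<Lambda> eta u z"
  shows "\<exists>g \<in> support_functionals smul eta u. g z = l"
proof -
  obtain \<phi> where \<phi>: "\<And>n. \<phi> n \<in> \<Lambda>" and norm_lim: "(\<lambda>n. norm (\<phi> n u)) \<longlonglongrightarrow> 1"
    and z_lim: "(\<lambda>n. conjugate (\<phi> n u) * \<phi> n z) \<longlonglongrightarrow> l"
    using l u by (auto simp: limit_values_def)
  have le: "norm (\<phi> n x) \<le> eta x" for n x
    using \<phi> ball dual_ball_norm_le by blast
  have lin: "\<phi> n (x + y) = \<phi> n x + \<phi> n y" "\<phi> n (smul c x) = c * \<phi> n x" for n x y c
    using \<phi>[of n] ball by (auto simp: dual_ball_def dual_def dual_linear_iff)
  define \<psi> where "\<psi> n x = conjugate (\<phi> n u) * \<phi> n x" for n x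
  have \<psi>_le: "norm (\<psi> n x) \<le> eta x" for n x
    using mult_mono[OF le[of n u] le[of n x]] by (simp add: \<psi>_def norm_mult u)
  obtain g G where G: "G \<noteq> bot" "G \<le> filtermap \<psi> sequentially"
    and g: "\<And>x. ((\<lambda>h. h x) \<longlongrightarrow> g x) G"
    by (rule pointwise_cluster_filter[of \<psi> eta, OF \<psi>_le]) blast
  have ev: "eventually P G" if "\<And>n. P (\<psi> n)" for P
    by (rule filter_leD[OF G(2)]) (simp add: eventually_filtermap that)
  have g_lim: "g x = a" if "(\<lambda>n. \<psi> n x) \<longlonglongrightarrow> a" for x a
  proof -
    have "((\<lambda>h. h x) \<longlongrightarrow> a) (filtermap \<psi> sequentially)"
      using that by (simp add: filterlim_filtermap)
    then have "((\<lambda>h. h x) \<longlongrightarrow> a) G"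
      using G(2) filterlim_mono by blast
    then show ?thesis
      using tendsto_unique[OF G(1) g] by blast
  qed
  have "g (x + y) = g x + g y" for x y
  proof (rule tendsto_unique[OF G(1) g])
    have "eventually (\<lambda>h. h x + h y = h (x + y)) G"
      by (rule ev) (simp add: \<psi>_def lin algebra_simps)
    then show "((\<lambda>h. h (x + y)) \<longlongrightarrow> g x + g y) G"
      by (rule Lim_transform_eventually[OF tendsto_add[OF g g]])
  qed
  moreover have "g (smul c x) = c * g x" for c x
  proof (rule tendsto_unique[OF G(1) g])
    have "eventually (\<lambda>h. c * h x = h (smul c x)) G"
      by (rule ev) (simp add: \<psi>_def lin algebra_simps)
    then show "((\<lambda>h. h (smul c x)) \<longlongrightarrow> c * g x) G"
      by (rule Lim_transform_eventually[OF tendsto_mult_left[OF g]])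
  qed
  moreover have "norm (g x) \<le> eta x" for x
    using \<psi>_le by (intro tendsto_upperbound[OF tendsto_norm[OF g] ev G(1)])
  moreover have "g u = 1"
  proof (rule g_lim)
    have "(\<lambda>n. of_real ((norm (\<phi> n u))\<^sup>2)) \<longlonglongrightarrow> (of_real (1\<^sup>2) :: 'k)"
      by (intro tendsto_of_real tendsto_power norm_lim)
    then show "(\<lambda>n. \<psi> n u) \<longlonglongrightarrow> 1"
      by (simp add: \<psi>_def conjugate_mult_self)
  qed
  ultimately have "g \<in> support_functionals smul eta u"
    using u by (intro support_functionalsI) (auto simp: dual_linear_iff)
  moreover have "g z = l"
    using z_lim by (intro g_lim) (simp add: \<psi>_def)
  ultimately show ?thesis by blast
qed

section \<open>Support values lie in the hull of the limit values\<close>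

text \<open>
  The limit values form the fibre over \<open>eta u\<close> of the closure of a set of pairs, which makes
  them closed without a diagonal argument. They are bounded because they are values of
  functionals dominated by \<open>eta\<close>.
\<close>

lemma compact_limit_values:
  assumes u: "eta u = 1" and ball: "\<Lambda> \<subseteq> dual_ball smul eta"
  shows "compact (limit_values \<Lambda> eta u z)"
proof -
  let ?S = "(\<lambda>\<phi>. (norm (\<phi> u), conjugate (\<phi> u) * \<phi> z)) ` \<Lambda>"
  have "limit_values \<Lambda> eta u z = Pair (eta u) -` closure ?S" (is "?L = ?R")
  proof
    show "?L \<subseteq> ?R"
    proof
      fix l assume "l \<in> ?L"
      then obtain \<phi> where \<phi>: "\<And>n::nat. \<phi> n \<in> \<Lambda>" "(\<lambda>n. norm (\<phi> n u)) \<longlonglongrightarrow> eta u"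
        "(\<lambda>n. conjugate (\<phi> n u) * \<phi> n z) \<longlonglongrightarrow> l"
        by (auto simp: limit_values_def)
      show "l \<in> ?R"
        unfolding vimage_eq closure_sequential using \<phi>(1) tendsto_Pair[OF \<phi>(2,3)]
        by (intro exI[where x = "\<lambda>n. (norm (\<phi> n u), conjugate (\<phi> n u) * \<phi> n z)"]) auto
    qed
    show "?R \<subseteq> ?L"
    proof
      fix l assume "l \<in> ?R"
      then obtain s where s: "\<And>n. s n \<in> ?S" "s \<longlonglongrightarrow> (eta u, l)"
        by (auto simp: closure_sequential)
      have "\<forall>n. \<exists>\<phi>. \<phi> \<in> \<Lambda> \<and> s n = (norm (\<phi> u), conjugate (\<phi> u) * \<phi> z)"
        using s(1) by blast
      then obtain \<phi> where \<phi>: "\<And>n. \<phi> n \<in> \<Lambda>"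
        "\<And>n. s n = (norm (\<phi> n u), conjugate (\<phi> n u) * \<phi> n z)"
        by (auto dest!: choice)
      have "(\<lambda>n. norm (\<phi> n u)) \<longlonglongrightarrow> eta u" "(\<lambda>n. conjugate (\<phi> n u) * \<phi> n z) \<longlonglongrightarrow> l"
        using tendsto_fst[OF s(2)] tendsto_snd[OF s(2)] by (simp_all add: \<phi>(2))
      then show "l \<in> ?L"
        using \<phi>(1) by (auto simp: limit_values_def)
    qed
  qed
  moreover have "closed (Pair (eta u) -` closure ?S)"
    by (intro closed_vimage closed_closure continuous_intros)
  moreover have "limit_values \<Lambda> eta u z \<subseteq> cball 0 (eta z)"
  proof
    fix l assume "l \<in> limit_values \<Lambda> eta u z"
    then obtain g where "g \<in> support_functionals smul eta u" "g z = l"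
      using limit_value_is_support_value[OF u ball] by blast
    then show "l \<in> cball 0 (eta z)"
      using support_functionals_subset_dual_ball dual_ball_norm_le by fastforce
  qed
  ultimately show ?thesis
    by (metis bounded_cball bounded_subset compact_eq_bounded_closed)
qed

text \<open>
  The error \<open>t\<^sup>2\<close> allowed in norming is of lower order than the first-order term that has to
  be detected. Squares of norms are compared through \<open>2 a - 1 \<le> a\<^sup>2\<close>, which keeps exactly
  the first-order information near \<open>a = 1\<close>.
\<close>

lemma norming_perturbed_vector:
  assumes u: "eta u = 1" and norming: "one_norming smul eta \<Lambda>"
    and g: "g \<in> support_functionals smul eta u" and t: "0 < t"
  obtains \<phi> where "\<phi> \<in> \<Lambda>"
    and "1 + t * inner d (g z) - t\<^sup>2 - t * (norm d * eta z) \<le> norm (\<phi> u)"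
    and "inner d (g z) - t - t * (norm d * eta z)\<^sup>2 / 2 \<le> inner d (conjugate (\<phi> u) * \<phi> z)"
proof -
  have ball: "\<Lambda> \<subseteq> dual_ball smul eta"
    and sup: "\<And>x. eta x = (SUP \<phi>\<in>\<Lambda>. norm (\<phi> x))"
    using norming by (auto simp: one_norming_def)
  have "\<Lambda> \<noteq> {}"
    using sup[of u] sup[of 0] u eta_zero by auto
  define x where "x = u + smul (of_real t * conjugate d) z"
  have expand: "\<phi> x = \<phi> u + t *\<^sub>R (conjugate d * \<phi> z)" if "\<phi> \<in> dual_ball smul eta" for \<phi>
    using that by (auto simp: x_def dual_ball_def dual_def dual_linear_iff scaleR_conv_of_real)
  have g_ball: "g \<in> dual_ball smul eta" and gu: "g u = 1"
    using g u by (auto simp: support_functionals_def dual_sphere_def dual_ball_def)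
  have "bdd_above ((\<lambda>\<phi>. norm (\<phi> x)) ` \<Lambda>)"
    using ball dual_ball_norm_le by (intro bdd_aboveI2[where M = "eta x"]) blast
  moreover have "eta x - t\<^sup>2 < (SUP \<phi>\<in>\<Lambda>. norm (\<phi> x))"
    using sup[of x] t by simp
  ultimately obtain \<phi> where \<phi>: "\<phi> \<in> \<Lambda>" "eta x - t\<^sup>2 < norm (\<phi> x)"
    using \<open>\<Lambda> \<noteq> {}\<close> by (auto simp: less_cSUP_iff)
  then have \<phi>_ball: "\<phi> \<in> dual_ball smul eta"
    using ball by blast
  (* The perturbation is conjugated so that its first-order effect is a product with d. *)
  have move: "inner p (conjugate d * q) = inner d (conjugate p * q)" for p q :: 'k
    by (metis inner_mult_left_conjugate mult.commute)
  have "1 + t * inner d (g z) = inner 1 (g x)"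
    using move[of 1 "g z"]
    by (simp add: expand[OF g_ball] gu inner_add_right conjugate_def dot_square_norm)
  also have "\<dots> \<le> norm (g x)"
    using norm_cauchy_schwarz[of 1 "g x"] by simp
  also have "\<dots> \<le> eta x"
    by (rule dual_ball_norm_le[OF g_ball])
  finally have lower: "1 + t * inner d (g z) - t\<^sup>2 \<le> norm (\<phi> x)"
    using \<phi>(2) by simp
  have \<phi>z: "norm (conjugate d * \<phi> z) \<le> norm d * eta z"
    using dual_ball_norm_le[OF \<phi>_ball, of z] by (simp add: norm_mult mult_left_mono)
  show thesis
  proof
    show "\<phi> \<in> \<Lambda>" by (fact \<phi>(1))
    have "norm (\<phi> x) \<le> norm (\<phi> u) + t * norm (conjugate d * \<phi> z)"
      using norm_triangle_ineq[of "\<phi> u" "t *\<^sub>R (conjugate d * \<phi> z)"] t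
      by (simp add: expand[OF \<phi>_ball])
    also have "\<dots> \<le> norm (\<phi> u) + t * (norm d * eta z)"
      using \<phi>z t by simp
    finally show "1 + t * inner d (g z) - t\<^sup>2 - t * (norm d * eta z) \<le> norm (\<phi> u)"
      using lower by simp
    define r where "r = inner d (conjugate (\<phi> u) * \<phi> z)"
    have "(norm (\<phi> x))\<^sup>2
        = (norm (\<phi> u))\<^sup>2 + 2 * t * r + t\<^sup>2 * (norm (conjugate d * \<phi> z))\<^sup>2"
      using dot_norm[of "\<phi> u" "t *\<^sub>R (conjugate d * \<phi> z)"]
      by (simp add: expand[OF \<phi>_ball] move r_def power_mult_distrib)
    also have "\<dots> \<le> 1 + 2 * t * r + t\<^sup>2 * (norm d * eta z)\<^sup>2"
    proof -
      have "(norm (\<phi> u))\<^sup>2 \<le> 1"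
        using dual_ball_norm_le[OF \<phi>_ball, of u] u by (simp add: power_le_one)
      moreover have "t\<^sup>2 * (norm (conjugate d * \<phi> z))\<^sup>2 \<le> t\<^sup>2 * (norm d * eta z)\<^sup>2"
        using \<phi>z by (intro mult_left_mono power_mono) auto
      ultimately show ?thesis by simp
    qed
    finally have upper: "(norm (\<phi> x))\<^sup>2 \<le> 1 + 2 * t * r + t\<^sup>2 * (norm d * eta z)\<^sup>2" .
    have "2 * norm (\<phi> x) - 1 \<le> (norm (\<phi> x))\<^sup>2"
      using zero_le_power2[of "norm (\<phi> x) - 1"] by (simp add: power2_diff)
    then have "2 * t * inner d (g z) - 2 * t\<^sup>2 \<le> 2 * t * r + t\<^sup>2 * (norm d * eta z)\<^sup>2"
      using lower upper by simp
    then have "2 * t * (inner d (g z) - t - t * (norm d * eta z)\<^sup>2 / 2) \<le> 2 * t * r"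
      by (simp add: algebra_simps power2_eq_square)
    then show "inner d (g z) - t - t * (norm d * eta z)\<^sup>2 / 2
        \<le> inner d (conjugate (\<phi> u) * \<phi> z)"
      using t by (simp add: r_def)
  qed
qed

text \<open>
  Letting \<open>t\<close> tend to \<open>0\<close> in the preceding lemma, the first bound forces
  \<open>norm (\<phi> u) \<rightarrow> 1\<close> and the second survives along a subsequence on which the products
  \<open>conjugate (\<phi> u) * \<phi> z\<close> converge.
\<close>

lemma limit_value_in_direction:
  assumes u: "eta u = 1" and norming: "one_norming smul eta \<Lambda>"
    and g: "g \<in> support_functionals smul eta u"
  shows "\<exists>l \<in> limit_values \<Lambda> eta u z. inner d (g z) \<le> inner d l"
proof -
  let ?s = "inner d (g z)" and ?D = "norm d * eta z"
  let ?t = "\<lambda>n. inverse (real (Suc n))"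
  have "\<exists>\<phi>. \<phi> \<in> \<Lambda> \<and> 1 + ?t n * ?s - (?t n)\<^sup>2 - ?t n * ?D \<le> norm (\<phi> u)
      \<and> ?s - ?t n - ?t n * ?D\<^sup>2 / 2 \<le> inner d (conjugate (\<phi> u) * \<phi> z)" for n
    by (rule norming_perturbed_vector[OF u norming g, of "?t n" d z]) auto
  then obtain \<phi> where \<phi>: "\<And>n. \<phi> n \<in> \<Lambda>"
    and norm_ge: "\<And>n. 1 + ?t n * ?s - (?t n)\<^sup>2 - ?t n * ?D \<le> norm (\<phi> n u)"
    and inner_ge: "\<And>n. ?s - ?t n - ?t n * ?D\<^sup>2 / 2 \<le> inner d (conjugate (\<phi> n u) * \<phi> n z)"
    by metis
  have le: "norm (\<phi> n x) \<le> eta x" for n x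
    using \<phi> norming dual_ball_norm_le by (auto simp: one_norming_def)
  have t: "?t \<longlonglongrightarrow> 0"
    by (rule LIMSEQ_inverse_real_of_nat)
  have norm_lim: "(\<lambda>n. norm (\<phi> n u)) \<longlonglongrightarrow> 1"
  proof (rule tendsto_sandwich)
    have "(\<lambda>n. 1 + ?t n * ?s - (?t n)\<^sup>2 - ?t n * ?D) \<longlonglongrightarrow> 1 + 0 * ?s - 0\<^sup>2 - 0 * ?D"
      by (intro tendsto_intros t)
    then show "(\<lambda>n. 1 + ?t n * ?s - (?t n)\<^sup>2 - ?t n * ?D) \<longlonglongrightarrow> 1" by simp
    show "eventually (\<lambda>n. norm (\<phi> n u) \<le> 1) sequentially"
      using le[of _ u] u by simp
  qed (use norm_ge in simp_all)
  define w where "w n = conjugate (\<phi> n u) * \<phi> n z" for n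
  have "norm (w n) \<le> eta z" for n
    using mult_mono[OF le[of n u] le[of n z]] by (simp add: w_def norm_mult u)
  then have "\<forall>n. w n \<in> cball 0 (eta z)" by simp
  then obtain l r where r: "strict_mono r" and l: "(w \<circ> r) \<longlonglongrightarrow> l"
    using compact_imp_seq_compact[OF compact_cball] by (metis seq_compactE)
  have "l \<in> limit_values \<Lambda> eta u z"
    unfolding limit_values_def using \<phi> l LIMSEQ_subseq_LIMSEQ[OF norm_lim r] u
    by (intro CollectI exI[where x = "\<phi> \<circ> r"]) (simp add: o_def w_def)
  moreover have "?s \<le> inner d l"
  proof (rule LIMSEQ_le)
    have "(\<lambda>n. ?s - ?t n - ?t n * ?D\<^sup>2 / 2) \<longlonglongrightarrow> ?s - 0 - 0 * ?D\<^sup>2 / 2"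
      by (intro tendsto_intros t) simp
    then show "((\<lambda>n. ?s - ?t n - ?t n * ?D\<^sup>2 / 2) \<circ> r) \<longlonglongrightarrow> ?s"
      using LIMSEQ_subseq_LIMSEQ r by fastforce
    show "(\<lambda>n. inner d ((w \<circ> r) n)) \<longlonglongrightarrow> inner d l"
      by (intro tendsto_intros l)
    show "\<exists>N. \<forall>n\<ge>N. ((\<lambda>n. ?s - ?t n - ?t n * ?D\<^sup>2 / 2) \<circ> r) n \<le> inner d ((w \<circ> r) n)"
      using inner_ge by (simp add: w_def)
  qed
  ultimately show ?thesis by blast
qed

lemma support_value_in_hull:
  assumes u: "eta u = 1" and norming: "one_norming smul eta \<Lambda>"
    and g: "g \<in> support_functionals smul eta u"
  shows "g z \<in> convex hull (limit_values \<Lambda> eta u z)"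
proof (rule ccontr)
  let ?H = "convex hull (limit_values \<Lambda> eta u z)"
  assume "g z \<notin> ?H"
  moreover have "closed ?H"
    using u norming
    by (intro compact_imp_closed compact_convex_hull compact_limit_values)
      (auto simp: one_norming_def)
  ultimately obtain a b where ab: "inner a (g z) < b" "\<And>x. x \<in> ?H \<Longrightarrow> b < inner a x"
    using separating_hyperplane_closed_point[OF convex_convex_hull] by metis
  obtain l where l: "l \<in> limit_values \<Lambda> eta u z" "inner (- a) (g z) \<le> inner (- a) l"
    using limit_value_in_direction[OF u norming g] by blast
  have "b < inner a l"
    using ab(2) l(1) by (simp add: hull_inc)
  then show False
    using ab(1) l(2) by simp
qed

theorem numerical_range_eq_hull_limit_values:
  assumes "eta u = 1" and "one_norming smul eta \<Lambda>"
  shows "numerical_range smul eta u z = convex hull (limit_values \<Lambda> eta u z)"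
proof
  show "numerical_range smul eta u z \<subseteq> convex hull (limit_values \<Lambda> eta u z)"
    unfolding numerical_range_def using support_value_in_hull[OF assms]
    by (intro hull_minimal convex_convex_hull) auto
  have "\<Lambda> \<subseteq> dual_ball smul eta"
    using assms(2) by (simp add: one_norming_def)
  then show "convex hull (limit_values \<Lambda> eta u z) \<subseteq> numerical_range smul eta u z"
    unfolding numerical_range_def using limit_value_is_support_value[OF assms(1)]
    by (intro hull_mono) blast
qed

end

section \<open>Real and complex scalars\<close>

theorem theorem2p4:
  shows
    "(\<forall>(smul :: real \<Rightarrow> 'a::ab_group_add \<Rightarrow> 'a) eta u \<Lambda>.
        seminormed_space smul eta \<longrightarrow>
        eta u = 1 \<longrightarrow>
        \<Lambda> \<subseteq> dual_ball smul eta \<inter> kernel_annihilator smul eta \<longrightarrow>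
        one_norming smul eta \<Lambda> \<longrightarrow>
        (\<forall>z. numerical_range smul eta u z =
          convex hull {l. \<exists>\<phi>. (\<forall>n::nat. \<phi> n \<in> \<Lambda>) \<and>
            (\<lambda>n. \<bar>\<phi> n u\<bar>) \<longlonglongrightarrow> eta u \<and>
            (\<lambda>n. \<phi> n u * \<phi> n z) \<longlonglongrightarrow> l}))
     \<and>
     (\<forall>(smul :: complex \<Rightarrow> 'b::ab_group_add \<Rightarrow> 'b) eta u \<Lambda>.
        seminormed_space smul eta \<longrightarrow>
        eta u = 1 \<longrightarrow>
        \<Lambda> \<subseteq> dual_ball smul eta \<inter> kernel_annihilator smul eta \<longrightarrow>
        one_norming smul eta \<Lambda> \<longrightarrow>
        (\<forall>z. numerical_range smul eta u z =
          convex hull {l. \<exists>\<phi>. (\<forall>n::nat. \<phi> n \<in> \<Lambda>) \<and>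
            (\<lambda>n. cmod (\<phi> n u)) \<longlonglongrightarrow> eta u \<and>
            (\<lambda>n. cnj (\<phi> n u) * \<phi> n z) \<longlonglongrightarrow> l}))"
proof (intro conjI allI impI)
  fix smul :: "real \<Rightarrow> 'a \<Rightarrow> 'a" and eta u \<Lambda> z
  assume space: "seminormed_space smul eta" and "eta u = 1" "one_norming smul eta \<Lambda>"
  interpret euclidean_seminormed_space smul eta
    using space by (simp add: euclidean_seminormed_space_def)
  show "numerical_range smul eta u z =
          convex hull {l. \<exists>\<phi>. (\<forall>n::nat. \<phi> n \<in> \<Lambda>) \<and>
            (\<lambda>n. \<bar>\<phi> n u\<bar>) \<longlonglongrightarrow> eta u \<and>
            (\<lambda>n. \<phi> n u * \<phi> n z) \<longlonglongrightarrow> l}"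
    using numerical_range_eq_hull_limit_values[OF \<open>eta u = 1\<close> \<open>one_norming smul eta \<Lambda>\<close>]
    by (simp add: limit_values_def)
next
  fix smul :: "complex \<Rightarrow> 'b \<Rightarrow> 'b" and eta u \<Lambda> z
  assume space: "seminormed_space smul eta" and "eta u = 1" "one_norming smul eta \<Lambda>"
  interpret euclidean_seminormed_space smul eta
    using space by (simp add: euclidean_seminormed_space_def)
  show "numerical_range smul eta u z =
          convex hull {l. \<exists>\<phi>. (\<forall>n::nat. \<phi> n \<in> \<Lambda>) \<and>
            (\<lambda>n. cmod (\<phi> n u)) \<longlonglongrightarrow> eta u \<and>
            (\<lambda>n. cnj (\<phi> n u) * \<phi> n z) \<longlonglongrightarrow> l}"
    using numerical_range_eq_hull_limit_values[OF \<open>eta u = 1\<close> \<open>one_norming smul eta \<Lambda>\<close>]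
    by (simp add: limit_values_def)
qed

end
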